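(* In the non-trivial regime where $\varepsilon_K,\varepsilon_N\ge0$ and $\varepsilon_K+\varepsilon_N<1$, the minimizers $(\mu_K^*,\mu_N^* )$ of $$\min_{\mu_K,\mu_N}\ \mathrm{KL}(\mu_K\,\|\,\mu_N)\quad\text{subject to}\quad \mathbb E_{\hat x\sim\mu_K}[1-\hat x]\le\varepsilon_K,\qquad \mathbb E_{\hat x\sim\mu_N}[\hat x]\le\varepsilon_N$$ are given by $$\mu_K^*=\mathrm{Bern}(1-\varepsilon_K),\qquad \mu_N^*=\mathrm{Bern}(\varepsilon_N).$$
   Context: The minimization is over Borel probability measures $\mu_K,\mu_N$ on $[0,1]$. $\mathrm{Bern}(a)=(1-a)\delta_0+a\delta_1$ is the Bernoulli distribution, viewed as a measure on $[0,1]$. $\mathrm{KL}$ is the Kullback–Leibler divergence with logarithm base 2.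
   Formalization: The Bernoulli pair is shown to be a minimizer in the whole regime, but the only one just when ε_N>0 or ε_K=0; if ε_N=0<ε_K, KL is +∞ on the whole feasible set, so every feasible pair is a minimizer and uniqueness fails. *)

theory Defs
  imports "HOL-Probability.Probability"
begin

abbreviation unit_interval_borel :: "real measure" where
  "unit_interval_borel \<equiv> restrict_space borel {0..1}"

text \<open>
  The library's \<^const>\<open>KL_divergence\<close> is real-valued: it is a junk value if the second
  measure below does not dominate the first, and \<open>0\<close> if the log-density is not integrable. Its
  argument order is also the reverse of \<open>KL(P \<parallel> Q)\<close>: the reference measure comes first.
  For probability measures \<open>P \<ll> Q\<close> the negative part of the log-density is always
  \<open>P\<close>-integrable, so non-integrability means that the integral is \<open>+\<infinity>\<close>.
\<close>

definition KL_div :: "real \<Rightarrow> 'a measure \<Rightarrow> 'a measure \<Rightarrow> ereal" where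
  "KL_div b P Q =
    (if absolutely_continuous Q P \<and> integrable P (entropy_density b Q P)
     then ereal (KL_divergence b Q P) else \<infinity>)"

definition Bern :: "real \<Rightarrow> real measure" where
  "Bern a = distr (measure_pmf (bernoulli_pmf a)) unit_interval_borel of_bool"

lemma emeasure_Bern:
  assumes "0 \<le> a" "a \<le> 1" "A \<in> sets unit_interval_borel"
  shows "emeasure (Bern a) A =
    ennreal (1 - a) * emeasure (return unit_interval_borel 0) A +
    ennreal a * emeasure (return unit_interval_borel 1) A"
proof -
  have m: "of_bool \<in> measure_pmf (bernoulli_pmf a) \<rightarrow>\<^sub>M unit_interval_borel"
    by (auto simp: space_restrict_space)
  have "emeasure (Bern a) A = (\<integral>\<^sup>+b. indicator (of_bool -` A) b \<partial>measure_pmf (bernoulli_pmf a))"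
    unfolding Bern_def using assms(3) m by (subst emeasure_distr) auto
  also have "\<dots> = ennreal a * indicator A 1 + ennreal (1 - a) * indicator A 0"
    using assms(1,2) by (simp add: nn_integral_bernoulli_pmf indicator_def mult.commute)
  finally show ?thesis
    using assms(3) by (simp add: add.commute)
qed

definition feasible :: "real \<Rightarrow> real \<Rightarrow> (real measure \<times> real measure) set" where
  "feasible \<epsilon>\<^sub>K \<epsilon>\<^sub>N =
    {(\<mu>\<^sub>K, \<mu>\<^sub>N). \<mu>\<^sub>K \<in> space (prob_algebra unit_interval_borel) \<and>
               \<mu>\<^sub>N \<in> space (prob_algebra unit_interval_borel) \<and>
               (\<integral>x. 1 - x \<partial>\<mu>\<^sub>K) \<le> \<epsilon>\<^sub>K \<and> (\<integral>x. x \<partial>\<mu>\<^sub>N) \<le> \<epsilon>\<^sub>N}"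

definition is_minimizer :: "real \<Rightarrow> real \<Rightarrow> real measure \<times> real measure \<Rightarrow> bool" where
  "is_minimizer \<epsilon>\<^sub>K \<epsilon>\<^sub>N =
    is_arg_min (\<lambda>(\<mu>\<^sub>K, \<mu>\<^sub>N). KL_div 2 \<mu>\<^sub>K \<mu>\<^sub>N) (\<lambda>\<mu>. \<mu> \<in> feasible \<epsilon>\<^sub>K \<epsilon>\<^sub>N)"

end

theory Submission
  imports Defs
begin

text \<open>
  With \<open>a = 1 - \<epsilon>\<^sub>K\<close> and \<open>c = \<epsilon>\<^sub>N > 0\<close>, the affine function
  \<open>h x = (1 - x) * (1 - a) / (1 - c) + x * a / c\<close> is the density of \<open>Bern a\<close> with respect to
  \<open>Bern c\<close>. For feasible \<open>P = D Q\<close>, integrating \<open>ln D \<ge> ln h + 1 - h / D\<close> with respect to \<open>P\<close>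
  bounds the divergence below by \<open>\<integral>ln h dP + 1 - \<integral>h dQ\<close>. As \<open>h\<close> is increasing and affine, the
  constraint on \<open>Q\<close> gives \<open>\<integral>h dQ \<le> 1\<close>; concavity of \<open>ln\<close> and the constraint on \<open>P\<close> bound
  \<open>\<integral>ln h dP\<close> by its value at \<open>Bern a\<close>. Equality in the concavity step forces \<open>P\<close>, and then \<open>Q\<close>,
  onto \<open>{0, 1}\<close>, and equality in the other steps fixes both means. If \<open>\<epsilon>\<^sub>N = 0\<close>, then \<open>Q\<close> is the
  point mass at \<open>0\<close>, no feasible \<open>P\<close> is dominated by it, and the divergence is always infinite.
\<close>

section \<open>Probability measures on the unit interval\<close>

lemma prob_algebra_unit_intervalD:
  assumes "M \<in> space (prob_algebra unit_interval_borel)"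
  shows "prob_space M" "sets M = sets unit_interval_borel" "space M = {0..1}"
proof -
  show "prob_space M" and *: "sets M = sets unit_interval_borel"
    using assms by (auto simp: space_prob_algebra)
  show "space M = {0..1}"
    using sets_eq_imp_space_eq[OF *] by (simp add: space_restrict_space)
qed

text \<open>Affine functions are given by their values \<open>p\<close> at 0 and \<open>q\<close> at
  1, the form in which \<open>h\<close> and \<open>L\<close> appear later. On the unit interval they
  are bounded.\<close>

lemma integrable_affine_unit_interval:
  fixes p q :: real
  assumes "M \<in> space (prob_algebra unit_interval_borel)"
  shows "integrable M (\<lambda>x. (1 - x) * p + x * q)"
proof -
  note M = prob_algebra_unit_intervalD[OF assms]
  interpret prob_space M by fact
  have meas: "(\<lambda>x. (1 - x) * p + x * q) \<in> borel_measurable M"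
    unfolding measurable_cong_sets[OF M(2) refl] by (intro measurable_restrict_space1) simp
  have "norm ((1 - x) * p + x * q) \<le> \<bar>p\<bar> + \<bar>q\<bar>" if "x \<in> {0..1}" for x
  proof -
    have "\<bar>(1 - x) * p\<bar> \<le> 1 * \<bar>p\<bar>" "\<bar>x * q\<bar> \<le> 1 * \<bar>q\<bar>"
      using that unfolding abs_mult by (intro mult_right_mono; simp)+
    then show ?thesis by simp
  qed
  then show ?thesis
    using meas M(3) by (intro integrable_const_bound[where B="\<bar>p\<bar> + \<bar>q\<bar>"]) auto
qed

lemma integral_affine_unit_interval:
  fixes p q :: real
  assumes "M \<in> space (prob_algebra unit_interval_borel)"
  shows "(\<integral>x. (1 - x) * p + x * q \<partial>M) = p + (\<integral>x. x \<partial>M) * (q - p)"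
proof -
  interpret prob_space M by (rule prob_algebra_unit_intervalD[OF assms])
  have i: "integrable M (\<lambda>x. x)"
    using integrable_affine_unit_interval[OF assms, of 0 1] by simp
  have "(\<integral>x. (1 - x) * p + x * q \<partial>M) = (\<integral>x. p + x * (q - p) \<partial>M)"
    by (intro Bochner_Integration.integral_cong) (auto simp: algebra_simps)
  also have "\<dots> = p + (\<integral>x. x \<partial>M) * (q - p)"
    using i by (simp add: prob_space)
  finally show ?thesis .
qed

lemma AE_eq_0_if_mean_le_0:
  assumes "M \<in> space (prob_algebra unit_interval_borel)" "(\<integral>x. x \<partial>M) \<le> 0"
  shows "AE x in M. x = 0"
proof -
  note M = prob_algebra_unit_intervalD[OF assms(1)]
  have i: "integrable M (\<lambda>x. x)"
    using integrable_affine_unit_interval[OF assms(1), of 0 1] by simp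
  have nn: "AE x in M. 0 \<le> x" using M(3) by auto
  have "(\<integral>x. x \<partial>M) = 0"
    using assms(2) integral_nonneg_AE[OF nn] by linarith
  then show ?thesis using integral_nonneg_eq_0_iff_AE[OF i nn] by simp
qed

lemma AE_eq_1_if_mean_ge_1:
  assumes "M \<in> space (prob_algebra unit_interval_borel)" "(\<integral>x. x \<partial>M) \<ge> 1"
  shows "AE x in M. x = 1"
proof -
  note M = prob_algebra_unit_intervalD[OF assms(1)]
  have i: "integrable M (\<lambda>x. 1 - x)"
    using integrable_affine_unit_interval[OF assms(1), of 1 0] by simp
  have nn: "AE x in M. 0 \<le> 1 - x" using M(3) by auto
  have "(\<integral>x. 1 - x \<partial>M) = 0"
    using assms(2) integral_nonneg_AE[OF nn] integral_affine_unit_interval[OF assms(1), of 1 0]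
    by simp
  then have "AE x in M. 1 - x = 0" using integral_nonneg_eq_0_iff_AE[OF i nn] by simp
  then show ?thesis by eventually_elim simp
qed

section \<open>Bernoulli measures\<close>

lemma measurable_of_bool_unit_interval:
  "(of_bool :: bool \<Rightarrow> real) \<in> measure_pmf p \<rightarrow>\<^sub>M unit_interval_borel"
  by (auto simp: space_restrict_space)

lemma Bern_in_prob_algebra: "Bern a \<in> space (prob_algebra unit_interval_borel)"
  unfolding Bern_def space_prob_algebra
  using prob_space.prob_space_distr[OF prob_space_measure_pmf measurable_of_bool_unit_interval]
  by auto

lemma integrable_Bern:
  fixes f :: "real \<Rightarrow> real"
  assumes "f \<in> borel_measurable unit_interval_borel"
  shows "integrable (Bern a) f"
  unfolding Bern_def
  by (subst integrable_distr_eq[OF measurable_of_bool_unit_interval assms])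
     (rule integrable_measure_pmf_finite, simp)

lemma integral_Bern:
  fixes f :: "real \<Rightarrow> real"
  assumes "0 \<le> a" "a \<le> 1" "f \<in> borel_measurable unit_interval_borel"
  shows "(\<integral>x. f x \<partial>Bern a) = (1 - a) * f 0 + a * f 1"
  unfolding Bern_def
  using assms(1,2) by (subst integral_distr[OF measurable_of_bool_unit_interval assms(3)]) simp

lemma Bern_singletons:
  assumes "0 \<le> a" "a \<le> 1"
  shows "emeasure (Bern a) {0} = ennreal (1 - a)" "emeasure (Bern a) {1} = ennreal a"
proof -
  have s: "{0} \<in> sets unit_interval_borel" "{1} \<in> sets unit_interval_borel"
    by (auto simp: sets_restrict_space_iff)
  show "emeasure (Bern a) {0} = ennreal (1 - a)" "emeasure (Bern a) {1} = ennreal a"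
    using s by (simp_all add: emeasure_Bern[OF assms])
qed

lemma sets_Bern: "sets (Bern a) = sets unit_interval_borel"
  by (simp add: Bern_def)

text \<open>Both atoms have positive mass, so neither lies in a null set. This turns an
  almost-everywhere identity for a Radon-Nikodym derivative into its values at 0 and 1.\<close>

lemma AE_Bern_singletons:
  assumes "0 < a" "a < 1" "AE x in Bern a. R x"
  shows "R 0" "R 1"
proof -
  obtain Z where Z: "{x \<in> space (Bern a). \<not> R x} \<subseteq> Z" "emeasure (Bern a) Z = 0" "Z \<in> sets (Bern a)"
    using assms(3) by (rule AE_E)
  have sp: "space (Bern a) = {0..1}"
    by (rule prob_algebra_unit_intervalD(3)[OF Bern_in_prob_algebra])
  have "z \<notin> Z" if "emeasure (Bern a) {z} > 0" for z
    using that emeasure_mono[of "{z}" Z "Bern a"] Z(2,3) by auto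
  then have "0 \<notin> Z" "1 \<notin> Z"
    using assms(1,2) by (simp_all add: Bern_singletons)
  then show "R 0" "R 1"
    using subsetD[OF Z(1), of 0] subsetD[OF Z(1), of 1] sp by auto
qed

text \<open>On {0, 1} every indicator agrees with the affine function having the same endpoint
  values, and the integral of that function is determined by the mean.\<close>

lemma eq_Bern_if_concentrated:
  assumes M: "M \<in> space (prob_algebra unit_interval_borel)"
    and AE: "AE x in M. x = 0 \<or> x = 1" and mean: "(\<integral>x. x \<partial>M) = a"
  shows "M = Bern a"
proof (rule measure_eqI)
  note MD = prob_algebra_unit_intervalD[OF M]
  interpret prob_space M by (rule MD)
  show "sets M = sets (Bern a)" by (simp add: MD sets_Bern)
  fix A assume A: "A \<in> sets M"
  \<comment> \<open>The formula for \<open>emeasure (Bern a)\<close> needs \<open>a\<close> in the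
    unit interval; being the mean of \<open>M\<close>, it is.\<close>
  have "(\<integral>x. x \<partial>M) \<ge> 0" by (rule integral_nonneg_AE) (use MD(3) in auto)
  moreover have "(\<integral>x. x \<partial>M) \<le> (\<integral>x. 1 \<partial>M)"
    using integrable_affine_unit_interval[OF M, of 0 1] MD(3)
    by (intro integral_mono_AE) auto
  ultimately have a: "0 \<le> a" "a \<le> 1" using mean by (simp_all add: prob_space)
  have "measure M A = (\<integral>x. indicator A x \<partial>M)"
    using A by simp
  also have "\<dots> = (\<integral>x. (1 - x) * indicator A 0 + x * indicator A 1 \<partial>M)"
    using A AE integrable_affine_unit_interval[OF M]
    by (intro integral_cong_AE) (auto simp: borel_measurable_integrable)
  also have "\<dots> = (1 - a) * indicator A 0 + a * indicator A 1"
    unfolding integral_affine_unit_interval[OF M] mean by (simp add: algebra_simps)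
  finally have "measure M A = (1 - a) * indicator A 0 + a * indicator A 1" .
  then have "emeasure M A = ennreal ((1 - a) * indicator A 0 + a * indicator A 1)"
    by (simp add: emeasure_eq_measure)
  also have "\<dots> = emeasure (Bern a) A"
    using A MD(2) a by (subst emeasure_Bern) (auto simp: indicator_def ennreal_plus[symmetric] simp del: ennreal_plus)
  finally show "emeasure M A = emeasure (Bern a) A" .
qed

lemma mean_Bern:
  assumes "0 \<le> a" "a \<le> 1"
  shows "(\<integral>x. x \<partial>Bern a) = a"
  using integral_Bern[OF assms, of "\<lambda>x. x"] by (simp add: measurable_restrict_space1)

lemma Bern_feasible:
  assumes "0 \<le> k" "k \<le> 1" "0 \<le> n" "n \<le> 1"
  shows "(Bern (1 - k), Bern n) \<in> feasible k n"
  using assms integral_affine_unit_interval[OF Bern_in_prob_algebra, of "1 - k" 1 0]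
  by (simp add: feasible_def Bern_in_prob_algebra mean_Bern)

text \<open>Only the values at the two atoms matter for the density. The affine interpolation is
  chosen because its integral under any measure on the unit interval depends on the mean
  alone.\<close>

lemma Bern_eq_density:
  assumes a: "0 \<le> a" "a \<le> 1" and c: "0 < c" "c < 1"
  shows "Bern a = density (Bern c) (\<lambda>x. ennreal ((1 - x) * ((1 - a) / (1 - c)) + x * (a / c)))"
    (is "_ = density _ (\<lambda>x. ennreal (?h x))")
proof (rule measure_eqI)
  have h: "?h \<in> borel_measurable (Bern c)"
    using integrable_affine_unit_interval[OF Bern_in_prob_algebra] by (rule borel_measurable_integrable)
  show "sets (Bern a) = sets (density (Bern c) (\<lambda>x. ennreal (?h x)))"
    by (simp add: sets_Bern)
  fix A assume "A \<in> sets (Bern a)"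
  then have A: "A \<in> sets unit_interval_borel" "A \<in> sets (Bern c)" by (simp_all add: sets_Bern)
  have m: "(\<lambda>x. ?h x * indicator A x) \<in> borel_measurable unit_interval_borel"
    using h A unfolding measurable_cong_sets[OF sets_Bern refl] by auto
  have nn: "AE x in Bern c. 0 \<le> ?h x * indicator A x"
    using a c prob_algebra_unit_intervalD(3)[OF Bern_in_prob_algebra]
    by (intro AE_I2) (auto intro!: mult_nonneg_nonneg add_nonneg_nonneg)
  have "emeasure (density (Bern c) (\<lambda>x. ennreal (?h x))) A = (\<integral>\<^sup>+x. ennreal (?h x * indicator A x) \<partial>Bern c)"
    using h A by (subst emeasure_density) (auto intro!: nn_integral_cong simp: indicator_def)
  also have "\<dots> = ennreal (\<integral>x. ?h x * indicator A x \<partial>Bern c)"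
    by (intro nn_integral_eq_integral integrable_Bern m nn)
  also have "\<dots> = ennreal ((1 - a) * indicator A 0 + a * indicator A 1)"
    using c by (subst integral_Bern[OF _ _ m]) auto
  also have "\<dots> = emeasure (Bern a) A"
    using A a by (subst emeasure_Bern) (auto simp: indicator_def ennreal_plus[symmetric] simp del: ennreal_plus)
  finally show "emeasure (Bern a) A = emeasure (density (Bern c) (\<lambda>x. ennreal (?h x))) A" ..
qed

lemma KL_div_Bern:
  assumes a: "0 \<le> a" "a \<le> 1" and c: "0 < c" "c < 1"
  shows "KL_div b (Bern a) (Bern c) =
    ereal ((1 - a) * log b ((1 - a) / (1 - c)) + a * log b (a / c))"
proof -
  let ?h = "\<lambda>x. (1 - x) * ((1 - a) / (1 - c)) + x * (a / c)"
  let ?D = "entropy_density b (Bern c) (Bern a)"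
  interpret Q: prob_space "Bern c" by (rule prob_algebra_unit_intervalD[OF Bern_in_prob_algebra])
  have h: "?h \<in> borel_measurable (Bern c)"
    using integrable_affine_unit_interval[OF Bern_in_prob_algebra] by (rule borel_measurable_integrable)
  have ac: "absolutely_continuous (Bern c) (Bern a)"
    unfolding Bern_eq_density[OF a c] using h by (intro absolutely_continuousI_density) auto
  have "AE x in Bern c. ennreal (?h x) = RN_deriv (Bern c) (Bern a) x"
    by (rule Q.RN_deriv_unique[OF measurable_compose[OF h measurable_ennreal]
      Bern_eq_density[OF a c, symmetric]])
  note RN = AE_Bern_singletons[OF c this]
  have D: "?D 0 = log b ((1 - a) / (1 - c))" "?D 1 = log b (a / c)"
    using a c by (simp_all add: entropy_density_def RN[symmetric])
  have m: "?D \<in> borel_measurable unit_interval_borel"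
    using measurable_entropy_density[of b "Bern c" "Bern a"]
    unfolding measurable_cong_sets[OF sets_Bern refl] .
  show ?thesis
    using ac by (simp add: KL_div_def integrable_Bern[OF m] KL_divergence_def integral_Bern[OF a m] D)
qed

section \<open>The lower bound\<close>

text \<open>Apply \<open>ln t \<le> t - 1\<close> at \<open>p / h\<close> and \<open>q / h\<close>,
  where \<open>h\<close> is the weighted mean: the right-hand sides average to 0. Strictness comes
  from \<open>p / h \<noteq> 1\<close>.\<close>

lemma ln_affine_strict_concave:
  fixes p q x :: real
  assumes "0 < p" "0 < q" "p \<noteq> q" "0 < x" "x < 1"
  shows "(1 - x) * ln p + x * ln q < ln ((1 - x) * p + x * q)"
proof -
  define h where "h = (1 - x) * p + x * q"
  have h: "0 < h" unfolding h_def using assms by (intro add_pos_pos mult_pos_pos) auto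
  have "h - p = x * (q - p)" by (simp add: h_def algebra_simps)
  then have "p / h \<noteq> 1" using assms h by auto
  then have "ln (p / h) < p / h - 1"
    using ln_le_minus_one[of "p / h"] ln_eq_minus_one[of "p / h"] assms h by fastforce
  then have "(1 - x) * ln (p / h) < (1 - x) * (p / h - 1)" using assms by simp
  moreover have "x * ln (q / h) \<le> x * (q / h - 1)"
    using ln_le_minus_one[of "q / h"] assms h by simp
  moreover have "(1 - x) * (p / h - 1) + x * (q / h - 1) = ((1 - x) * p + x * q) / h - 1"
    by (simp add: add_divide_distrib diff_divide_distrib algebra_simps)
  then have "(1 - x) * (p / h - 1) + x * (q / h - 1) = 0"
    using h unfolding h_def[symmetric] by simp
  ultimately have "(1 - x) * ln (p / h) + x * ln (q / h) < 0" by linarith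
  then show ?thesis
    using assms h unfolding h_def[symmetric] by (simp add: ln_div algebra_simps)
qed

text \<open>
  A slack form of Gibbs' inequality: \<open>h\<close> plays the role of the optimal density, and \<open>L\<close> is an
  integrable minorant of \<open>ln h\<close>, so that \<open>ln h\<close> itself need not be integrable.
\<close>

lemma KL_div_lower_bound:
  fixes h L :: "'a \<Rightarrow> real"
  assumes Q: "prob_space Q" and P: "prob_space P" and sets: "sets P = sets Q"
    and b: "1 < b"
    and h: "integrable Q h" "\<And>x. x \<in> space Q \<Longrightarrow> 0 \<le> h x" "(\<integral>x. h x \<partial>Q) \<le> 1"
    and L: "integrable P L" "AE x in P. 0 < h x \<and> L x \<le> ln (h x)"
    and V: "V \<le> (\<integral>x. L x \<partial>P)"
  shows "ereal (V / ln b) \<le> KL_div b P Q"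
    and "KL_div b P Q = ereal (V / ln b) \<Longrightarrow>
      (AE x in P. L x = ln (h x)) \<and> (\<integral>x. L x \<partial>P) = V \<and> (\<integral>x. h x \<partial>Q) = 1 \<and>
      (\<forall>R. (AE x in P. R x) \<longrightarrow> (AE x in Q. R x \<or> h x = 0))"
proof -
  interpret Q: prob_space Q by fact
  interpret P: prob_space P by fact
  note [measurable] = borel_measurable_integrable[OF h(1)]
  \<comment> \<open>Outside the case treated here the divergence is infinite, so the bound is
    trivial and equality cannot occur.\<close>
  have main: "V / ln b \<le> KL_divergence b Q P \<and> (KL_divergence b Q P = V / ln b \<longrightarrow>
      (AE x in P. L x = ln (h x)) \<and> (\<integral>x. L x \<partial>P) = V \<and> (\<integral>x. h x \<partial>Q) = 1 \<and>
      (\<forall>R. (AE x in P. R x) \<longrightarrow> (AE x in Q. R x \<or> h x = 0)))"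
    if ac: "absolutely_continuous Q P" and int: "integrable P (entropy_density b Q P)"
  proof -
    obtain D where D [measurable]: "D \<in> borel_measurable Q"
      and RN: "AE x in Q. RN_deriv Q P x = ennreal (D x)"
      and D_pos: "AE x in P. 0 < D x" and D_nn: "\<And>x. 0 \<le> D x"
      using Q.real_RN_deriv[OF P.finite_measure_axioms ac sets] by metis
    have "density Q (RN_deriv Q P) = density Q (\<lambda>x. ennreal (D x))"
      using RN by (intro density_cong) auto
    then have P_eq: "P = density Q (\<lambda>x. ennreal (D x))"
      using Q.density_RN_deriv[OF ac sets] by simp
    have D_P: "D \<in> borel_measurable P"
      unfolding measurable_cong_sets[OF sets refl] by (rule D)
    have RN_P: "AE x in P. RN_deriv Q P x = ennreal (D x)"
      by (rule absolutely_continuous_AE[OF sets ac RN])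
    have ed: "AE x in P. entropy_density b Q P x * ln b = ln (D x)"
      using RN_P by eventually_elim
        (use b D_nn in \<open>simp add: entropy_density_def log_def enn2real_ennreal\<close>)
    have int_ed: "integrable P (\<lambda>x. entropy_density b Q P x * ln b)"
      using int by simp
    have int_D: "integrable P (\<lambda>x. ln (D x))"
      by (rule integrable_cong_AE_imp[OF int_ed _ ed]) (intro borel_measurable_ln D_P)
    have "(\<integral>x. entropy_density b Q P x * ln b \<partial>P) = (\<integral>x. ln (D x) \<partial>P)"
      using int_D int_ed by (intro integral_cong_AE[OF _ _ ed]) (auto simp only: borel_measurable_integrable)
    then have KL: "(\<integral>x. ln (D x) \<partial>P) = KL_divergence b Q P * ln b"
      unfolding KL_divergence_def by simp
    \<comment> \<open>Since \<open>h x / 0 = 0\<close>, integrating \<open>h / D\<close> against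
      \<open>P\<close> recovers only the part of the \<open>Q\<close>-integral of \<open>h\<close>
      where \<open>D\<close> is nonzero. The part on \<open>D = 0\<close> is kept as a separate
      slack.\<close>
    have restrict: "D x * (h x / D x) = (if D x = 0 then 0 else h x)" for x by simp
    have int_hif: "integrable Q (\<lambda>x. if D x = 0 then 0 else h x)"
      by (rule Bochner_Integration.integrable_bound[OF h(1)]) auto
    have int_hD: "integrable P (\<lambda>x. h x / D x)"
      unfolding P_eq
      by (subst integrable_real_density) (use D_nn int_hif in \<open>auto simp: restrict\<close>)
    have eq_hD: "(\<integral>x. h x / D x \<partial>P) = (\<integral>x. (if D x = 0 then 0 else h x) \<partial>Q)"
      unfolding P_eq
      by (subst integral_real_density) (use D_nn in \<open>auto simp: restrict\<close>)
    have int_h0: "integrable Q (\<lambda>x. if D x = 0 then h x else 0)"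
      by (rule Bochner_Integration.integrable_bound[OF h(1)]) auto
    have split: "(\<integral>x. h x \<partial>Q) = (\<integral>x. h x / D x \<partial>P) + (\<integral>x. (if D x = 0 then h x else 0) \<partial>Q)"
      unfolding eq_hD Bochner_Integration.integral_add[OF int_hif int_h0, symmetric]
      by (intro Bochner_Integration.integral_cong) auto
    have h0_nn: "AE x in Q. 0 \<le> (if D x = 0 then h x else 0)"
      using h(2) by auto
    have slack_h: "0 \<le> (\<integral>x. (if D x = 0 then h x else 0) \<partial>Q)"
      by (rule integral_nonneg_AE[OF h0_nn])
    \<comment> \<open>\<open>G\<close> is the sum of two gaps that are nonnegative
      \<open>P\<close>-almost everywhere: \<open>ln h - L\<close>, and
      \<open>h / D - 1 - ln (h / D)\<close>.\<close>
    define G where "G = (\<lambda>x. ln (D x) - L x - 1 + h x / D x)"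
    have int_G: "integrable P G"
      unfolding G_def using int_D L(1) int_hD by auto
    have G_ge: "AE x in P. 0 \<le> ln (h x) - L x \<and> ln (h x) - L x \<le> G x"
      using L(2) D_pos
    proof eventually_elim
      case (elim x)
      then have "ln (h x / D x) \<le> h x / D x - 1" by (intro ln_le_minus_one) auto
      then show ?case using elim by (simp add: G_def ln_div)
    qed
    then have G_nn: "AE x in P. 0 \<le> G x" by eventually_elim auto
    have slack_G: "0 \<le> (\<integral>x. G x \<partial>P)"
      by (rule integral_nonneg_AE[OF G_nn])
    have int_G_eq: "(\<integral>x. G x \<partial>P) =
        KL_divergence b Q P * ln b - (\<integral>x. L x \<partial>P) - 1 + (\<integral>x. h x / D x \<partial>P)"
      unfolding G_def using int_D L(1) int_hD by (simp add: KL P.prob_space)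
    have lnb: "0 < ln b" using b by simp
    \<comment> \<open>The difference of the two sides is a sum of four nonnegative slacks: the
      integral of \<open>G\<close>, the excess of the integral of \<open>L\<close> over
      \<open>V\<close>, the deficit of the integral of \<open>h\<close> from 1, and the mass of
      \<open>h\<close> on \<open>D = 0\<close>. Equality makes each of them vanish.\<close>
    have "V \<le> KL_divergence b Q P * ln b"
      using int_G_eq slack_G slack_h split h(3) V by linarith
    moreover have "(AE x in P. L x = ln (h x)) \<and> (\<integral>x. L x \<partial>P) = V \<and> (\<integral>x. h x \<partial>Q) = 1 \<and>
        (\<forall>R. (AE x in P. R x) \<longrightarrow> (AE x in Q. R x \<or> h x = 0))"
      if "KL_divergence b Q P * ln b = V"
    proof (intro conjI allI impI)
      show "(\<integral>x. L x \<partial>P) = V" "(\<integral>x. h x \<partial>Q) = 1"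
        using that int_G_eq slack_G slack_h split h(3) V by linarith+
      have G0: "(\<integral>x. G x \<partial>P) = 0" and h0: "(\<integral>x. (if D x = 0 then h x else 0) \<partial>Q) = 0"
        using that int_G_eq slack_G slack_h split h(3) V by linarith+
      have "AE x in P. G x = 0"
        using G0 integral_nonneg_eq_0_iff_AE[OF int_G G_nn] by simp
      then show "AE x in P. L x = ln (h x)"
        using G_ge by eventually_elim auto
      have h_zero: "AE x in Q. (if D x = 0 then h x else 0) = 0"
        using h0 integral_nonneg_eq_0_iff_AE[OF int_h0 h0_nn] by simp
      \<comment> \<open>Where \<open>D > 0\<close>, \<open>P\<close>-null sets are
        \<open>Q\<close>-null; where \<open>D = 0\<close>, the vanishing slack gives
        \<open>h = 0\<close>.\<close>
      fix R assume "AE x in P. R x"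
      then have "AE x in Q. 0 < ennreal (D x) \<longrightarrow> R x"
        unfolding P_eq by (subst (asm) AE_density) auto
      then show "AE x in Q. R x \<or> h x = 0"
        using h_zero by eventually_elim (use D_nn in \<open>auto simp: less_le split: if_splits\<close>)
    qed
    ultimately show ?thesis
      using lnb by (auto simp: field_simps)
  qed
  show "ereal (V / ln b) \<le> KL_div b P Q"
    using main by (auto simp: KL_div_def)
  show "KL_div b P Q = ereal (V / ln b) \<Longrightarrow>
      (AE x in P. L x = ln (h x)) \<and> (\<integral>x. L x \<partial>P) = V \<and> (\<integral>x. h x \<partial>Q) = 1 \<and>
      (\<forall>R. (AE x in P. R x) \<longrightarrow> (AE x in Q. R x \<or> h x = 0))"
    using main by (auto simp: KL_div_def split: if_splits)
qed

section \<open>The bound and its equality case for feasible pairs\<close>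

lemma KL_div_feasible_lower_bound:
  assumes k: "0 \<le> k" and n: "0 < n" and kn: "k + n < 1"
    and feas: "(P, Q) \<in> feasible k n"
  shows "KL_div 2 (Bern (1 - k)) (Bern n) \<le> KL_div 2 P Q"
    and "KL_div 2 P Q = KL_div 2 (Bern (1 - k)) (Bern n) \<Longrightarrow> P = Bern (1 - k) \<and> Q = Bern n"
proof -
  \<comment> \<open>\<open>r0\<close> and \<open>r1\<close> are the density values of
    \<open>Bern (1 - k)\<close> with respect to \<open>Bern n\<close> at 0 and 1. \<open>L\<close>
    is the chord of \<open>ln h\<close> when \<open>k > 0\<close>, and \<open>V\<close> is the
    Bernoulli divergence in natural units.\<close>
  define r0 where "r0 = k / (1 - n)"
  define r1 where "r1 = (1 - k) / n"
  define h where "h = (\<lambda>x::real. (1 - x) * r0 + x * r1)"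
  define L where "L = (\<lambda>x::real. (1 - x) * ln r0 + x * ln r1)"
  define V where "V = k * ln r0 + (1 - k) * ln r1"
  \<comment> \<open>Both \<open>r0 < 1\<close> and \<open>1 < r1\<close> rephrase
    \<open>k + n < 1\<close>; hence \<open>h\<close> is strictly increasing.\<close>
  have r0: "0 \<le> r0" "r0 < 1" "k > 0 \<Longrightarrow> r0 > 0" "k = 0 \<Longrightarrow> r0 = 0"
    and r1: "1 < r1"
    using k n kn by (auto simp: r0_def r1_def)
  have P: "P \<in> space (prob_algebra unit_interval_borel)"
    and Q: "Q \<in> space (prob_algebra unit_interval_borel)"
    and mP': "(\<integral>x. 1 - x \<partial>P) \<le> k" and mQ: "(\<integral>x. x \<partial>Q) \<le> n"
    using feas by (auto simp: feasible_def)
  note PD = prob_algebra_unit_intervalD[OF P] and QD = prob_algebra_unit_intervalD[OF Q]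
  have mP: "1 - k \<le> (\<integral>x. x \<partial>P)"
    using mP' integral_affine_unit_interval[OF P, of 1 0] by simp
  have P1: "AE x in P. x = 1" if "k = 0"
    using AE_eq_1_if_mean_ge_1[OF P] mP that by simp
  have KL_Bern: "KL_div 2 (Bern (1 - k)) (Bern n) = ereal (V / ln 2)"
    using k n kn by (simp add: KL_div_Bern V_def r0_def r1_def log_def add_divide_distrib)
  have h_mean: "(\<integral>x. h x \<partial>Q) = 1 + ((\<integral>x. x \<partial>Q) - n) * (r1 - r0)"
  proof -
    have "r0 + n * (r1 - r0) = (1 - n) * r0 + n * r1" by (simp add: algebra_simps)
    also have "\<dots> = 1" using n kn k by (simp add: r0_def r1_def)
    finally show ?thesis
      unfolding h_def integral_affine_unit_interval[OF Q] by (simp add: algebra_simps)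
  qed
  have L_mean: "(\<integral>x. L x \<partial>P) = V + ((\<integral>x. x \<partial>P) - (1 - k)) * (ln r1 - ln r0)"
    unfolding L_def integral_affine_unit_interval[OF P] V_def by (simp add: algebra_simps)
  \<comment> \<open>For \<open>k = 0\<close> we have \<open>r0 = 0\<close> and the junk value \<open>ln r0 = 0\<close>.\<close>
  have lnr: "ln r0 < ln r1"
    using r0 r1 k by (cases "k = 0") auto
  \<comment> \<open>For \<open>k = 0\<close>, \<open>h\<close> vanishes at 0 and \<open>L\<close>
    exceeds \<open>ln h\<close> just to the right of it. The claim is then restricted to
    \<open>x = 1\<close>, where the constraint puts all of \<open>P\<close>.\<close>
  have conc: "0 < h x \<and> L x \<le> ln (h x) \<and> (L x = ln (h x) \<longrightarrow> x = 0 \<or> x = 1)"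
    if "0 \<le> x" "x \<le> 1" "k = 0 \<longrightarrow> x = 1" for x
  proof (cases "x = 0 \<or> x = 1")
    case True
    then show ?thesis using that r0 r1 k by (auto simp: h_def L_def)
  next
    case False
    then have *: "0 < x" "x < 1" "0 < r0" using that r0 k by auto
    have "0 < h x" unfolding h_def using * r1 by (intro add_pos_pos mult_pos_pos) auto
    moreover have "L x < ln (h x)"
      unfolding L_def h_def using * r0 r1 by (intro ln_affine_strict_concave) auto
    ultimately show ?thesis by simp
  qed
  have AE_conc: "AE x in P. 0 < h x \<and> L x \<le> ln (h x) \<and> (L x = ln (h x) \<longrightarrow> x = 0 \<or> x = 1)"
  proof (cases "k = 0")
    case True
    show ?thesis using P1[OF True] by eventually_elim (rule conc, auto)
  next
    case False
    then show ?thesis using conc PD(3) by (intro AE_I2) auto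
  qed
  have h_nn: "0 \<le> h x" if "x \<in> space Q" for x
    unfolding h_def using that QD(3) r0 r1 by (intro add_nonneg_nonneg mult_nonneg_nonneg) auto
  have h_int: "integrable Q h" and L_int: "integrable P L"
    unfolding h_def L_def using integrable_affine_unit_interval P Q by blast+
  have h_le: "(\<integral>x. h x \<partial>Q) \<le> 1"
    unfolding h_mean using mQ r0 r1 by (simp add: mult_nonpos_nonneg)
  have V_le: "V \<le> (\<integral>x. L x \<partial>P)"
    unfolding L_mean using mP lnr by simp
  have AE_L: "AE x in P. 0 < h x \<and> L x \<le> ln (h x)"
    using AE_conc by eventually_elim auto
  have s: "sets P = sets Q" by (simp add: PD QD)
  note bound = KL_div_lower_bound[OF QD(1) PD(1) s _ h_int h_nn h_le L_int AE_L V_le, of 2]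
  show "KL_div 2 (Bern (1 - k)) (Bern n) \<le> KL_div 2 P Q"
    unfolding KL_Bern by (rule bound(1)) auto
  assume "KL_div 2 P Q = KL_div 2 (Bern (1 - k)) (Bern n)"
  then have eq: "AE x in P. L x = ln (h x)" "(\<integral>x. L x \<partial>P) = V" "(\<integral>x. h x \<partial>Q) = 1"
    and transfer: "\<And>R. (AE x in P. R x) \<Longrightarrow> (AE x in Q. R x \<or> h x = 0)"
    using bound(2) unfolding KL_Bern by auto
  have P01: "AE x in P. x = 0 \<or> x = 1"
    using eq(1) AE_conc by eventually_elim auto
  \<comment> \<open>Any mass of \<open>Q\<close> not controlled by \<open>P\<close> sits on zeros of
    \<open>h\<close>, and the only possible zero is the endpoint 0.\<close>
  have "h x = 0 \<longrightarrow> x = 0" if "x \<in> space Q" for x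
  proof
    assume "h x = 0"
    moreover have "0 \<le> (1 - x) * r0" "0 \<le> x * r1" using that QD(3) r0 r1 by auto
    ultimately have "x * r1 = 0" unfolding h_def by linarith
    then show "x = 0" using r1 by simp
  qed
  then have "AE x in Q. h x = 0 \<longrightarrow> x = 0" by (intro AE_I2)
  then have Q01: "AE x in Q. x = 0 \<or> x = 1"
    using transfer[OF P01] by eventually_elim auto
  \<comment> \<open>The slopes in \<open>L_mean\<close> and \<open>h_mean\<close> are nonzero, so
    equality of the integrals pins down both means.\<close>
  have "(\<integral>x. x \<partial>P) = 1 - k" using eq(2) lnr unfolding L_mean by simp
  moreover have "(\<integral>x. x \<partial>Q) = n" using eq(3) r0 r1 unfolding h_mean by simp
  ultimately show "P = Bern (1 - k) \<and> Q = Bern n"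
    using eq_Bern_if_concentrated P Q P01 Q01 by blast
qed

section \<open>The degenerate case of a zero mean bound on \<open>Q\<close>\<close>

lemma KL_div_feasible_0:
  assumes k: "k < 1" and feas: "(P, Q) \<in> feasible k 0"
  shows "KL_div b P Q = \<infinity>"
proof -
  have P: "P \<in> space (prob_algebra unit_interval_borel)"
    and Q: "Q \<in> space (prob_algebra unit_interval_borel)"
    and mP: "(\<integral>x. 1 - x \<partial>P) \<le> k" and mQ: "(\<integral>x. x \<partial>Q) \<le> 0"
    using feas by (auto simp: feasible_def)
  note PD = prob_algebra_unit_intervalD[OF P] and QD = prob_algebra_unit_intervalD[OF Q]
  have "\<not> absolutely_continuous Q P"
  proof
    assume ac: "absolutely_continuous Q P"
    have "sets P = sets Q" by (simp add: PD QD)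
    then have "AE x in P. x = 0"
      using absolutely_continuous_AE ac AE_eq_0_if_mean_le_0[OF Q mQ] by blast
    then have "(\<integral>x. x \<partial>P) = 0"
      by (rule integral_eq_zero_AE)
    then show False
      using mP k integral_affine_unit_interval[OF P, of 1 0] by simp
  qed
  then show ?thesis by (simp add: KL_div_def)
qed

text \<open>Uniqueness is conditional because for
  \<open>\<epsilon>\<^sub>N = 0 < \<epsilon>\<^sub>K\<close> every feasible pair has infinite
  divergence and so is a minimizer; \<open>Bern 1\<close> and
  \<open>Bern (1 - \<epsilon>\<^sub>K)\<close> are then both possible first components. If both
  bounds are 0, the divergence is again infinite, but only one pair is feasible.\<close>

theorem theorem4p3:
  fixes \<epsilon>\<^sub>K \<epsilon>\<^sub>N :: real
  assumes "0 \<le> \<epsilon>\<^sub>K" and "0 \<le> \<epsilon>\<^sub>N" and "\<epsilon>\<^sub>K + \<epsilon>\<^sub>N < 1"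
  shows "is_minimizer \<epsilon>\<^sub>K \<epsilon>\<^sub>N (Bern (1 - \<epsilon>\<^sub>K), Bern \<epsilon>\<^sub>N) \<and>
    (\<epsilon>\<^sub>N > 0 \<or> \<epsilon>\<^sub>K = 0 \<longrightarrow>
      {\<mu>. is_minimizer \<epsilon>\<^sub>K \<epsilon>\<^sub>N \<mu>} = {(Bern (1 - \<epsilon>\<^sub>K), Bern \<epsilon>\<^sub>N)})"
proof -
  let ?B = "(Bern (1 - \<epsilon>\<^sub>K), Bern \<epsilon>\<^sub>N)"
  have feas: "?B \<in> feasible \<epsilon>\<^sub>K \<epsilon>\<^sub>N"
    using assms by (intro Bern_feasible) auto
  have iff: "is_minimizer \<epsilon>\<^sub>K \<epsilon>\<^sub>N (P, Q) \<longleftrightarrow> (P, Q) \<in> feasible \<epsilon>\<^sub>K \<epsilon>\<^sub>N \<and>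
      (\<forall>P' Q'. (P', Q') \<in> feasible \<epsilon>\<^sub>K \<epsilon>\<^sub>N \<longrightarrow> KL_div 2 P Q \<le> KL_div 2 P' Q')" for P Q
    by (auto simp: is_minimizer_def is_arg_min_def not_less)
  have "KL_div 2 (Bern (1 - \<epsilon>\<^sub>K)) (Bern \<epsilon>\<^sub>N) \<le> KL_div 2 P Q"
    if PQ: "(P, Q) \<in> feasible \<epsilon>\<^sub>K \<epsilon>\<^sub>N" for P Q
  proof (cases "\<epsilon>\<^sub>N = 0")
    case True
    then have "KL_div 2 P Q = \<infinity>"
      using PQ assms by (intro KL_div_feasible_0[of "\<epsilon>\<^sub>K"]) simp_all
    then show ?thesis by simp
  next
    case False
    then have "0 < \<epsilon>\<^sub>N" using assms by simp
    then show ?thesis by (rule KL_div_feasible_lower_bound(1)[OF assms(1) _ assms(3) PQ])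
  qed
  then have min: "is_minimizer \<epsilon>\<^sub>K \<epsilon>\<^sub>N ?B"
    unfolding iff using feas by blast
  have uniq: "P = Bern (1 - \<epsilon>\<^sub>K) \<and> Q = Bern \<epsilon>\<^sub>N"
    if cond: "\<epsilon>\<^sub>N > 0 \<or> \<epsilon>\<^sub>K = 0" and PQ: "is_minimizer \<epsilon>\<^sub>K \<epsilon>\<^sub>N (P, Q)" for P Q
  proof (cases "\<epsilon>\<^sub>N = 0")
    case True
    with cond have "\<epsilon>\<^sub>K = 0" by simp
    have "(P, Q) \<in> feasible \<epsilon>\<^sub>K \<epsilon>\<^sub>N" using PQ unfolding iff by blast
    then have P: "P \<in> space (prob_algebra unit_interval_borel)"
      and Q: "Q \<in> space (prob_algebra unit_interval_borel)"
      and mP: "(\<integral>x. 1 - x \<partial>P) \<le> 0" and mQ: "(\<integral>x. x \<partial>Q) \<le> 0"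
      by (simp_all add: feasible_def True \<open>\<epsilon>\<^sub>K = 0\<close>)
    \<comment> \<open>Optimality says nothing here; feasibility alone forces the point masses at 1
      and 0.\<close>
    have P1: "AE x in P. x = 1"
      using mP integral_affine_unit_interval[OF P, of 1 0] by (intro AE_eq_1_if_mean_ge_1[OF P]) simp
    have Q0: "AE x in Q. x = 0"
      by (rule AE_eq_0_if_mean_le_0[OF Q mQ])
    have "AE x in P. 1 - x = 0" using P1 by eventually_elim simp
    then have "(\<integral>x. 1 - x \<partial>P) = 0" by (rule integral_eq_zero_AE)
    then have "(\<integral>x. x \<partial>P) = 1"
      using integral_affine_unit_interval[OF P, of 1 0] by simp
    moreover have "(\<integral>x. x \<partial>Q) = 0" using Q0 by (rule integral_eq_zero_AE)
    moreover have "AE x in P. x = 0 \<or> x = 1" using P1 by eventually_elim simp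
    moreover have "AE x in Q. x = 0 \<or> x = 1" using Q0 by eventually_elim simp
    ultimately show ?thesis
      using eq_Bern_if_concentrated P Q True \<open>\<epsilon>\<^sub>K = 0\<close> by simp
  next
    case False
    then have n: "0 < \<epsilon>\<^sub>N" using assms by simp
    have PQ_feas: "(P, Q) \<in> feasible \<epsilon>\<^sub>K \<epsilon>\<^sub>N"
      and "KL_div 2 P Q \<le> KL_div 2 (Bern (1 - \<epsilon>\<^sub>K)) (Bern \<epsilon>\<^sub>N)"
      using PQ feas unfolding iff by blast+
    then show ?thesis
      using KL_div_feasible_lower_bound[OF assms(1) n assms(3) PQ_feas] by (meson order_antisym)
  qed
  show ?thesis
  proof (intro conjI impI min)
    assume "\<epsilon>\<^sub>N > 0 \<or> \<epsilon>\<^sub>K = 0"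
    then show "{\<mu>. is_minimizer \<epsilon>\<^sub>K \<epsilon>\<^sub>N \<mu>} = {?B}"
      using min uniq by (intro set_eqI) (metis mem_Collect_eq prod.exhaust singleton_iff)
  qed
qed

end
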